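(* Let $\mathbb{X}, \mathbb{Y}, \mathbb{Z}$ be finite-dimensional real Banach spaces, each of dimension strictly greater than $1$. Let $\mathcal{T} \in \mathscr{B}(\mathbb{X} \times \mathbb{Y}, \mathbb{Z})$ be a non-zero bounded bilinear operator. Then $\mathcal{T}$ is a smooth point in $\mathscr{B}(\mathbb{X} \times \mathbb{Y}, \mathbb{Z})$ if and only if there exists $(x_0,y_0) \in S_{\mathbb{X} \times \mathbb{Y}}$ such that $M_{\mathcal{T}} = \{(\pm x_0, \pm y_0)\}$ and $\mathcal{T}(x_0,y_0)$ is a smooth point in $\mathbb{Z}$.
   Context: The product $\mathbb{X} \times \mathbb{Y}$ carries the norm $\|(x,y)\| = \max\{\|x\|,\|y\|\}$, and $S_{\mathbb{X} \times \mathbb{Y}}$ is its unit sphere. For a bilinear operator $\mathcal{T}: \mathbb{X} \times \mathbb{Y} \to \mathbb{Z}$ (linear in each argument), $\|\mathcal{T}\| = \sup\{\|\mathcal{T}(x,y)\| : (x,y) \in S_{\mathbb{X} \times \mathbb{Y}}\}$; $\mathcal{T}$ is bounded if $\|\mathcal{T}\|<\infty$. $\mathscr{B}(\mathbb{X} \times \mathbb{Y}, \mathbb{Z})$ is the Banach space of all bounded bilinear operators with this norm. The norm attainment set is $M_{\mathcal{T}} = \{(x,y) \in S_{\mathbb{X} \times \mathbb{Y}} : \|\mathcal{T}(x,y)\| = \|\mathcal{T}\|\}$. The notation $\{(\pm x_0,\pm y_0)\}$ means $\{(x_0,y_0),(x_0,-y_0),(-x_0,y_0),(-x_0,-y_0)\}$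 (independent signs). A Banach space $E$ is smooth at $u$ with $\|u\|=1$ if there is a unique supporting hyperplane to the closed unit ball of $E$ at $u$; a non-zero $u \in E$ is a smooth point of $E$ if $E$ is smooth at $u/\|u\|$. *)

theory Defs
  imports "HOL-Analysis.Analysis"
begin

text \<open>
  The library norm on \<open>'a \<times> 'b\<close> is the Euclidean one, so the unit sphere for the norm
  \<open>max (norm x) (norm y)\<close> is introduced separately.
\<close>

definition prod_sphere :: "('a::real_normed_vector \<times> 'b::real_normed_vector) set" where
  "prod_sphere = {(x, y). max (norm x) (norm y) = 1}"

text \<open>
  The library's \<open>bounded_bilinear\<close> asks for a bound \<open>norm (f x y) \<le> norm x * norm y * K\<close>; this
  is the same as bilinearity together with a finite supremum over \<open>prod_sphere\<close>.
\<close>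

lemma bdd_above_prod_sphere:
  assumes "bounded_bilinear f"
  shows "bdd_above ((\<lambda>(x, y). norm (f x y)) ` prod_sphere)"
proof -
  obtain K where K: "K \<ge> 0" "\<And>x y. norm (f x y) \<le> norm x * norm y * K"
    using bounded_bilinear.nonneg_bounded[OF assms] by blast
  have "norm (f x y) \<le> K" if "(x, y) \<in> prod_sphere" for x y
  proof -
    have "norm x \<le> 1" "norm y \<le> 1"
      using that by (auto simp: prod_sphere_def)
    then have "norm x * norm y \<le> 1"
      by (simp add: mult_le_one)
    then have "norm x * norm y * K \<le> 1 * K"
      using K(1) by (rule mult_right_mono)
    then show ?thesis
      using K(2)[of x y] by simp
  qed
  then show ?thesis
    by (auto intro!: bdd_aboveI[of _ K])
qed

lemma bounded_bilinear_iff_bdd_above: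
  "bounded_bilinear f \<longleftrightarrow>
    bilinear f \<and> bdd_above ((\<lambda>(x, y). norm (f x y)) ` prod_sphere)" (is "_ \<longleftrightarrow> ?r")
proof
  assume f: "bounded_bilinear f"
  then interpret bounded_bilinear f .
  show ?r
    using bdd_above_prod_sphere[OF f]
    by (auto simp: bilinear_def linear_iff add_left add_right scaleR_left scaleR_right)
next
  assume r: ?r
  then obtain K where K: "\<And>x y. (x, y) \<in> prod_sphere \<Longrightarrow> norm (f x y) \<le> K"
    unfolding bdd_above_def by fastforce
  have lin: "\<And>x. linear (\<lambda>y. f x y)" "\<And>y. linear (\<lambda>x. f x y)"
    using r by (auto simp: bilinear_def)
  have "norm (f x y) \<le> norm x * norm y * K" for x y
  proof (cases "x = 0 \<or> y = 0")
    case True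
    then show ?thesis
      using linear_0[OF lin(1)[of x]] linear_0[OF lin(2)[of y]] by auto
  next
    case False
    have "norm (f (sgn x) (sgn y)) \<le> K"
      using False by (intro K) (auto simp: prod_sphere_def norm_sgn)
    moreover have "f x y = (norm x * norm y) *\<^sub>R f (sgn x) (sgn y)"
      using False
      by (simp add: sgn_div_norm linear_scale[OF lin(1)] linear_scale[OF lin(2)] field_simps)
    ultimately show ?thesis
      by (simp add: mult_left_mono abs_mult)
  qed
  then show "bounded_bilinear f"
    by (intro bounded_bilinear.intro exI[of _ K])
      (auto simp: linear_add[OF lin(1)] linear_add[OF lin(2)]
        linear_scale[OF lin(1)] linear_scale[OF lin(2)])
qed

lemma bounded_bilinear_zero_fun: "bounded_bilinear (\<lambda>x y. 0)"
  by (rule bounded_bilinear.intro) (auto intro: exI[of _ 0])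

lemma bounded_bilinear_add_fun:
  assumes "bounded_bilinear f" "bounded_bilinear g"
  shows "bounded_bilinear (\<lambda>x y. f x y + g x y)"
proof -
  interpret f: bounded_bilinear f by fact
  interpret g: bounded_bilinear g by fact
  obtain K L where K: "\<And>x y. norm (f x y) \<le> norm x * norm y * K"
    and L: "\<And>x y. norm (g x y) \<le> norm x * norm y * L"
    using f.bounded g.bounded by blast
  have "norm (f x y + g x y) \<le> norm x * norm y * (K + L)" for x y
    using norm_triangle_ineq[of "f x y" "g x y"] K[of x y] L[of x y]
    by (simp add: distrib_left)
  then show ?thesis
    by (intro bounded_bilinear.intro exI[of _ "K + L"])
      (simp_all add: f.add_left f.add_right g.add_left g.add_right
        f.scaleR_left f.scaleR_right g.scaleR_left g.scaleR_right scaleR_add_right)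
qed

lemma bounded_bilinear_scaleR_fun:
  assumes "bounded_bilinear f"
  shows "bounded_bilinear (\<lambda>x y. r *\<^sub>R f x y)"
proof -
  interpret f: bounded_bilinear f by fact
  obtain K where K: "\<And>x y. norm (f x y) \<le> norm x * norm y * K"
    using f.bounded by blast
  have "norm (r *\<^sub>R f x y) \<le> norm x * norm y * (\<bar>r\<bar> * K)" for x y
    using mult_left_mono[OF K[of x y], of "\<bar>r\<bar>"] by (simp add: ac_simps)
  then show ?thesis
    by (intro bounded_bilinear.intro exI[of _ "\<bar>r\<bar> * K"])
      (simp_all add: f.add_left f.add_right f.scaleR_left f.scaleR_right scaleR_add_right)
qed

lemma bounded_bilinear_minus_fun:
  "bounded_bilinear f \<Longrightarrow> bounded_bilinear (\<lambda>x y. - f x y)"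
  using bounded_bilinear_scaleR_fun[of f "-1"] by simp

typedef (overloaded) ('a, 'b, 'c) bounded_bilin =
  "{f :: 'a::real_normed_vector \<Rightarrow> 'b::real_normed_vector \<Rightarrow> 'c::real_normed_vector.
      bounded_bilinear f}"
  morphisms bilin_apply Bounded_Bilin
  using bounded_bilinear_zero_fun by blast

setup_lifting type_definition_bounded_bilin

lemma bounded_bilin_eqI:
  "(\<And>x y. bilin_apply S x y = bilin_apply T x y) \<Longrightarrow> S = T"
  by (simp add: bilin_apply_inject[symmetric] fun_eq_iff)

lemma bounded_bilinear_bilin_apply: "bounded_bilinear (bilin_apply T)"
  using bilin_apply[of T] by simp

text \<open>
  Inserting 0 only matters when \<open>prod_sphere\<close> is empty, i.e. when both argument spaces are
  trivial, where the real-valued \<open>Sup\<close> is unspecified; see \<open>norm_bounded_bilin_eq_SUP\<close>.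
\<close>

instantiation bounded_bilin ::
  (real_normed_vector, real_normed_vector, real_normed_vector) real_normed_vector
begin

definition norm_bounded_bilin :: "('a, 'b, 'c) bounded_bilin \<Rightarrow> real" where
  "norm_bounded_bilin T =
    Sup (insert 0 ((\<lambda>(x, y). norm (bilin_apply T x y)) ` prod_sphere))"

lift_definition zero_bounded_bilin :: "('a, 'b, 'c) bounded_bilin" is "\<lambda>x y. 0"
  by (rule bounded_bilinear_zero_fun)

lift_definition uminus_bounded_bilin :: "('a, 'b, 'c) bounded_bilin \<Rightarrow> ('a, 'b, 'c) bounded_bilin"
  is "\<lambda>f x y. - f x y"
  by (rule bounded_bilinear_minus_fun)

lift_definition plus_bounded_bilin ::
  "('a, 'b, 'c) bounded_bilin \<Rightarrow> ('a, 'b, 'c) bounded_bilin \<Rightarrow> ('a, 'b, 'c) bounded_bilin"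
  is "\<lambda>f g x y. f x y + g x y"
  by (rule bounded_bilinear_add_fun)

lift_definition scaleR_bounded_bilin ::
  "real \<Rightarrow> ('a, 'b, 'c) bounded_bilin \<Rightarrow> ('a, 'b, 'c) bounded_bilin"
  is "\<lambda>r f x y. r *\<^sub>R f x y"
  by (rule bounded_bilinear_scaleR_fun)

definition minus_bounded_bilin ::
  "('a, 'b, 'c) bounded_bilin \<Rightarrow> ('a, 'b, 'c) bounded_bilin \<Rightarrow> ('a, 'b, 'c) bounded_bilin" where
  "minus_bounded_bilin S T = S + - T"

definition dist_bounded_bilin ::
  "('a, 'b, 'c) bounded_bilin \<Rightarrow> ('a, 'b, 'c) bounded_bilin \<Rightarrow> real" where
  "dist_bounded_bilin S T = norm (S - T)"

definition sgn_bounded_bilin :: "('a, 'b, 'c) bounded_bilin \<Rightarrow> ('a, 'b, 'c) bounded_bilin" where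
  "sgn_bounded_bilin T = scaleR (inverse (norm T)) T"

definition [code del]:
  "(uniformity :: (('a, 'b, 'c) bounded_bilin \<times> ('a, 'b, 'c) bounded_bilin) filter) =
    (INF e\<in>{0 <..}. principal {(S, T). dist S T < e})"

definition open_bounded_bilin :: "('a, 'b, 'c) bounded_bilin set \<Rightarrow> bool" where [code del]:
  "open_bounded_bilin U =
    (\<forall>S\<in>U. \<forall>\<^sub>F (S', T) in uniformity. S' = S \<longrightarrow> T \<in> U)"

lemma norm_bilin_apply_le:
  fixes T :: "('a, 'b, 'c) bounded_bilin"
  shows "(x, y) \<in> prod_sphere \<Longrightarrow> norm (bilin_apply T x y) \<le> norm T"
  unfolding norm_bounded_bilin_def
  using bdd_above_prod_sphere[OF bounded_bilinear_bilin_apply[of T]]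
  by (intro cSup_upper) force+

lemma norm_bounded_bilin_nonneg: "0 \<le> norm (T :: ('a, 'b, 'c) bounded_bilin)"
  unfolding norm_bounded_bilin_def
  using bdd_above_prod_sphere[OF bounded_bilinear_bilin_apply[of T]]
  by (intro cSup_upper) force+

lemma norm_bounded_bilin_le:
  fixes T :: "('a, 'b, 'c) bounded_bilin"
  assumes "0 \<le> K" "\<And>x y. (x, y) \<in> prod_sphere \<Longrightarrow> norm (bilin_apply T x y) \<le> K"
  shows "norm T \<le> K"
  unfolding norm_bounded_bilin_def using assms by (intro cSup_least) auto

lemma norm_bounded_bilin_eq_0:
  fixes T :: "('a, 'b, 'c) bounded_bilin"
  shows "norm T = 0 \<longleftrightarrow> T = 0"
proof
  assume T: "norm T = 0"
  interpret T: bounded_bilinear "bilin_apply T"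
    by (rule bounded_bilinear_bilin_apply)
  have "bilin_apply T x y = 0" for x y
  proof (cases "x = 0 \<or> y = 0")
    case True
    then show ?thesis
      by (auto simp: T.zero_left T.zero_right)
  next
    case False
    then have "(sgn x, sgn y) \<in> prod_sphere"
      by (simp add: prod_sphere_def norm_sgn)
    then have "bilin_apply T (sgn x) (sgn y) = 0"
      using norm_bilin_apply_le[of "sgn x" "sgn y" T] T by simp
    then show ?thesis
      using False by (simp add: sgn_div_norm T.scaleR_left T.scaleR_right)
  qed
  then show "T = 0"
    by (intro bounded_bilin_eqI) (simp add: zero_bounded_bilin.rep_eq)
next
  assume "T = 0"
  then show "norm T = 0"
    by (intro antisym norm_bounded_bilin_le norm_bounded_bilin_nonneg)
      (simp_all add: zero_bounded_bilin.rep_eq)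
qed

lemma norm_bounded_bilin_scaleR_le:
  fixes T :: "('a, 'b, 'c) bounded_bilin"
  shows "norm (r *\<^sub>R T) \<le> \<bar>r\<bar> * norm T"
  by (intro norm_bounded_bilin_le)
    (auto simp: scaleR_bounded_bilin.rep_eq norm_bounded_bilin_nonneg
      intro!: mult_left_mono norm_bilin_apply_le)

instance
proof
  fix S T :: "('a, 'b, 'c) bounded_bilin" and R :: "('a, 'b, 'c) bounded_bilin"
    and U :: "('a, 'b, 'c) bounded_bilin set" and r s :: real
  note rep_eqs = zero_bounded_bilin.rep_eq uminus_bounded_bilin.rep_eq plus_bounded_bilin.rep_eq
    scaleR_bounded_bilin.rep_eq
  show "S - T = S + - T"
    by (rule minus_bounded_bilin_def)
  show "S + T + R = S + (T + R)" "S + T = T + S" "0 + S = S" "- S + S = 0"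
    by (simp_all add: rep_eqs bounded_bilin_eqI ac_simps)
  show "r *\<^sub>R (S + T) = r *\<^sub>R S + r *\<^sub>R T"
    by (simp add: rep_eqs bounded_bilin_eqI scaleR_add_right)
  show "(r + s) *\<^sub>R S = r *\<^sub>R S + s *\<^sub>R S"
    by (simp add: rep_eqs bounded_bilin_eqI scaleR_add_left)
  show "r *\<^sub>R s *\<^sub>R S = (r * s) *\<^sub>R S"
    by (simp add: rep_eqs bounded_bilin_eqI)
  show "1 *\<^sub>R S = S"
    by (simp add: rep_eqs bounded_bilin_eqI)
  show "dist S T = norm (S - T)"
    by (rule dist_bounded_bilin_def)
  show "sgn S = inverse (norm S) *\<^sub>R S"
    by (rule sgn_bounded_bilin_def)
  show "uniformity = (INF e\<in>{0 <..}. principal {(S, T). dist S (T :: ('a, 'b, 'c) bounded_bilin) < e})"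
    by (rule uniformity_bounded_bilin_def)
  show "open U = (\<forall>S\<in>U. \<forall>\<^sub>F (S', T) in uniformity. S' = S \<longrightarrow> T \<in> U)"
    by (rule open_bounded_bilin_def)
  show "norm S = 0 \<longleftrightarrow> S = 0"
    by (rule norm_bounded_bilin_eq_0)
  show "norm (S + T) \<le> norm S + norm T"
    by (rule norm_bounded_bilin_le)
      (auto simp: plus_bounded_bilin.rep_eq norm_bounded_bilin_nonneg
        intro: norm_triangle_le add_mono norm_bilin_apply_le)
  show "norm (r *\<^sub>R S) = \<bar>r\<bar> * norm S"
  proof (cases "r = 0")
    case True
    then show ?thesis
      using norm_bounded_bilin_scaleR_le[of r S] norm_bounded_bilin_nonneg[of "r *\<^sub>R S"] by simp
  next
    case False
    have "inverse r *\<^sub>R r *\<^sub>R S = S"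
      using False by (simp add: rep_eqs bounded_bilin_eqI)
    then have "norm S \<le> \<bar>inverse r\<bar> * norm (r *\<^sub>R S)"
      using norm_bounded_bilin_scaleR_le[of "inverse r" "r *\<^sub>R S"] by simp
    then have "\<bar>r\<bar> * norm S \<le> norm (r *\<^sub>R S)"
      using False by (simp add: field_simps)
    then show ?thesis
      using norm_bounded_bilin_scaleR_le[of r S] by simp
  qed
qed

end

lemma norm_bounded_bilin_eq_SUP:
  fixes T :: "('a::real_normed_vector, 'b::real_normed_vector, 'c::real_normed_vector) bounded_bilin"
  assumes "(prod_sphere :: ('a \<times> 'b) set) \<noteq> {}"
  shows "norm T = (SUP (x, y)\<in>prod_sphere. norm (bilin_apply T x y))"
proof (rule antisym)
  have bdd: "bdd_above ((\<lambda>(x, y). norm (bilin_apply T x y)) ` prod_sphere)"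
    by (rule bdd_above_prod_sphere[OF bounded_bilinear_bilin_apply])
  have le: "norm (bilin_apply T x y) \<le> (SUP (x, y)\<in>prod_sphere. norm (bilin_apply T x y))"
    if "(x, y) \<in> prod_sphere" for x y
    using cSUP_upper[OF that bdd] by simp
  show "norm T \<le> (SUP (x, y)\<in>prod_sphere. norm (bilin_apply T x y))"
  proof (rule norm_bounded_bilin_le)
    obtain p :: "'a \<times> 'b" where "p \<in> prod_sphere"
      using assms by blast
    then show "0 \<le> (SUP (x, y)\<in>prod_sphere. norm (bilin_apply T x y))"
      using le[of "fst p" "snd p"] by (simp add: order_trans[OF norm_ge_zero])
  qed (rule le)
  show "(SUP (x, y)\<in>prod_sphere. norm (bilin_apply T x y)) \<le> norm T"
    using assms by (intro cSUP_least) (auto intro: norm_bilin_apply_le)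
qed

text \<open>
  A supporting hyperplane of \<open>B\<close> at \<open>u\<close> is treated as a set of points, so that uniqueness
  does not see the scaling of the functional describing it.
\<close>

definition supporting_hyperplane ::
  "'a::real_normed_vector set \<Rightarrow> 'a \<Rightarrow> 'a set \<Rightarrow> bool" where
  "supporting_hyperplane B u H \<longleftrightarrow>
    (\<exists>f c. bounded_linear f \<and> f \<noteq> (\<lambda>x. 0) \<and> H = {x. f x = (c::real)} \<and>
      u \<in> H \<and> (\<forall>x\<in>B. f x \<le> c))"

definition smooth_at :: "'a::real_normed_vector \<Rightarrow> bool" where
  "smooth_at u \<longleftrightarrow> norm u = 1 \<and> (\<exists>!H. supporting_hyperplane (cball 0 1) u H)"

definition smooth_point :: "'a::real_normed_vector \<Rightarrow> bool" where
  "smooth_point u \<longleftrightarrow> u \<noteq> 0 \<and> smooth_at (u /\<^sub>R norm u)"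

definition norm_attainment_set ::
  "('a::real_normed_vector, 'b::real_normed_vector, 'c::real_normed_vector) bounded_bilin
    \<Rightarrow> ('a \<times> 'b) set" where
  "norm_attainment_set T = {(x, y) \<in> prod_sphere. norm (bilin_apply T x y) = norm T}"

end

theory Submission
  imports Defs
begin

text \<open>
  Smoothness at \<open>u\<close> means that \<open>u\<close> has exactly one norming functional. If \<open>T\<close> attains its norm at
  \<open>(x, y)\<close> and \<open>g\<close> norms \<open>T x y\<close>, then \<open>S \<mapsto> g (S x y)\<close> norms \<open>T\<close>; evaluating such functionals on
  rank-one operators shows that they determine \<open>g\<close> and, up to signs, \<open>(x, y)\<close>. Conversely, if \<open>T\<close>
  attains its norm only at \<open>(\<plusminus>x, \<plusminus>y)\<close>, then a functional \<open>\<phi>\<close> norming \<open>T\<close> is dominated by the one-sided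
  derivative of the norm of the codomain at \<open>T x y\<close> in direction \<open>S x y\<close>. Hence \<open>\<phi> S\<close> depends
  only on \<open>S x y\<close>, through a functional that norms \<open>T x y\<close>.
\<close>

section \<open>Norming functionals\<close>

definition sublinear :: "('a::real_vector \<Rightarrow> real) \<Rightarrow> bool" where
  "sublinear p \<longleftrightarrow> (\<forall>x y. p (x + y) \<le> p x + p y) \<and> (\<forall>c x. 0 \<le> c \<longrightarrow> p (c *\<^sub>R x) = c * p x)"

lemma sublinear_add: "sublinear p \<Longrightarrow> p (x + y) \<le> p x + p y"
  and sublinear_scaleR: "sublinear p \<Longrightarrow> 0 \<le> c \<Longrightarrow> p (c *\<^sub>R x) = c * p x"
  by (auto simp: sublinear_def)

lemma sublinear_0: "sublinear p \<Longrightarrow> p 0 = 0"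
  using sublinear_scaleR[of p 0 0] by simp

lemma sublinear_minus_ge: "sublinear p \<Longrightarrow> - p x \<le> p (- x)"
  using sublinear_add[of p x "- x"] sublinear_0[of p] by simp

text \<open>The witness is the right directional derivative of \<open>p\<close> at \<open>v\<close>.\<close>

lemma sublinear_odd_at:
  assumes p: "sublinear p"
  obtains q where "sublinear q" "\<And>x. q x \<le> p x" "q (- v) = - p v" "q v = p v"
proof -
  \<comment> \<open>By homogeneity, for \<open>t > 0\<close> the value \<open>F x t\<close> is the
    difference quotient of \<open>p\<close> at \<open>v\<close> in direction \<open>x\<close> with
    step \<open>1 / t\<close>, and \<open>F x 0 = p x\<close>. The limit of vanishing step thus
    becomes an infimum over \<open>t\<close>.\<close>
  define F where "F x t = p (x + t *\<^sub>R v) - t * p v" for x t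
  define q where "q x = (INF t\<in>{0..}. F x t)" for x
  have low: "- p (- x) \<le> F x t" if "t \<ge> 0" for x t
    using sublinear_add[OF p, of "x + t *\<^sub>R v" "- x"] sublinear_scaleR[OF p that, of v]
    by (simp add: F_def)
  have q_le: "q x \<le> F x t" if "t \<ge> 0" for x t
    unfolding q_def using that low by (intro cINF_lower bdd_belowI2[of _ "- p (- x)"]) auto
  have q_ge: "m \<le> q x" if "\<And>t. t \<ge> 0 \<Longrightarrow> m \<le> F x t" for x m
    unfolding q_def using that by (intro cINF_greatest) auto
  have q_p: "q x \<le> p x" for x
    using q_le[of 0 x] by (simp add: F_def)
  have q0: "q 0 = 0"
    using q_p[of 0] q_ge[of 0 0] by (simp add: F_def sublinear_scaleR[OF p] sublinear_0[OF p])
  have q_add: "q (x + y) \<le> q x + q y" for x y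
  proof -
    have *: "q (x + y) \<le> F x s + F y t" if "s \<ge> 0" "t \<ge> 0" for s t
    proof -
      have "q (x + y) \<le> F (x + y) (s + t)"
        using that by (intro q_le) auto
      also have "\<dots> \<le> F x s + F y t"
        using sublinear_add[OF p, of "x + s *\<^sub>R v" "y + t *\<^sub>R v"]
        by (simp add: F_def algebra_simps)
      finally show ?thesis .
    qed
    have "q (x + y) - F x s \<le> q y" if "s \<ge> 0" for s
      using *[OF that] by (intro q_ge) (simp add: algebra_simps)
    then have "q (x + y) - q y \<le> q x"
      by (intro q_ge) (simp add: algebra_simps)
    then show ?thesis by simp
  qed
  \<comment> \<open>Replacing \<open>t\<close> by \<open>c * t\<close> turns
    \<open>F (c *\<^sub>R x)\<close> into \<open>c * F x t\<close>. The reverse inequality comes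
    later from the factor \<open>1 / c\<close>.\<close>
  have q_scale_le: "q (c *\<^sub>R x) \<le> c * q x" if "c > 0" for c x
  proof -
    have "q (c *\<^sub>R x) / c \<le> q x"
    proof (rule q_ge)
      fix t :: real assume "t \<ge> 0"
      then have "q (c *\<^sub>R x) \<le> F (c *\<^sub>R x) (c * t)"
        using that by (intro q_le) simp
      also have "\<dots> = c * F x t"
        using that sublinear_scaleR[OF p, of c "x + t *\<^sub>R v"]
        by (simp add: F_def algebra_simps)
      finally show "q (c *\<^sub>R x) / c \<le> F x t"
        using that by (simp add: field_simps)
    qed
    then show ?thesis using that by (simp add: field_simps)
  qed
  have "q (c *\<^sub>R x) = c * q x" if "c \<ge> 0" for c x
  proof (cases "c = 0")
    case False
    then have "c > 0" using that by simp
    then show ?thesis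
      using q_scale_le[of c x] q_scale_le[of "1 / c" "c *\<^sub>R x"]
      by (simp add: field_simps)
  qed (simp add: q0)
  then have q: "sublinear q"
    using q_add by (simp add: sublinear_def)
  \<comment> \<open>At \<open>t = 1\<close> the argument \<open>- v + t *\<^sub>R v\<close>
    vanishes.\<close>
  have "q (- v) \<le> - p v"
    using q_le[of 1 "- v"] sublinear_0[OF p] by (simp add: F_def)
  then have "q (- v) = - p v" "q v = p v"
    using q_p[of v] sublinear_minus_ge[OF q, of v] by auto
  with q q_p show thesis
    by (rule that)
qed

text \<open>Lowering a sublinear functional cannot destroy oddness already achieved at a point.\<close>

lemma sublinear_odd_on:
  assumes "finite B" "sublinear p"
  obtains q where "sublinear q" "\<And>x. q x \<le> p x" "\<And>b. b \<in> B \<Longrightarrow> q (- b) = - q b"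
  using assms
proof (induction B arbitrary: thesis rule: finite_induct)
  case empty
  then show ?case by blast
next
  case (insert b B)
  obtain r where r: "sublinear r" "\<And>x. r x \<le> p x" "\<And>b. b \<in> B \<Longrightarrow> r (- b) = - r b"
    using insert.IH insert.prems(2) by blast
  obtain q where q: "sublinear q" "\<And>x. q x \<le> r x" "q (- b) = - r b" "q b = r b"
    using sublinear_odd_at[OF r(1)] by blast
  have "q (- c) = - q c" if "c \<in> B" for c
    using r(3)[OF that] q(2)[of c] q(2)[of "- c"] sublinear_minus_ge[OF q(1), of c] by linarith
  then show ?case
    using q r(2) by (intro insert.prems(1)[of q]) (auto intro: order_trans)
qed

text \<open>The points where a sublinear functional is odd form a subspace, so oddness spreads from
  a spanning set to the whole space. There, subadditivity at \<open>x, y\<close> and at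
  \<open>- x, - y\<close> gives both halves of additivity.\<close>

lemma linear_if_odd_on_spanning:
  assumes q: "sublinear q" and B: "span B = UNIV" and odd: "\<And>b. b \<in> B \<Longrightarrow> q (- b) = - q b"
  shows "linear q"
proof -
  have "subspace {x. q (- x) = - q x}"
  proof (rule subspaceI)
    fix x y assume *: "x \<in> {x. q (- x) = - q x}" "y \<in> {x. q (- x) = - q x}"
    then show "x + y \<in> {x. q (- x) = - q x}"
      using sublinear_add[OF q, of x y] sublinear_add[OF q, of "- x" "- y"]
        sublinear_minus_ge[OF q, of "x + y"] by simp
    fix c :: real
    show "c *\<^sub>R x \<in> {x. q (- x) = - q x}"
      using * sublinear_scaleR[OF q, of "\<bar>c\<bar>" x] sublinear_scaleR[OF q, of "\<bar>c\<bar>" "- x"]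
      by (cases "c \<ge> 0") auto
  qed (simp add: sublinear_0[OF q])
  then have "span B \<subseteq> {x. q (- x) = - q x}"
    using odd by (intro span_minimal) auto
  then have odd: "q (- x) = - q x" for x
    using B by auto
  show ?thesis
  proof (rule linearI)
    fix x y
    show "q (x + y) = q x + q y"
      using sublinear_add[OF q, of x y] sublinear_add[OF q, of "- x" "- y"] odd[of x] odd[of y]
        odd[of "x + y"] by simp
    fix c :: real
    show "q (c *\<^sub>R x) = c *\<^sub>R q x"
      using sublinear_scaleR[OF q, of "\<bar>c\<bar>" x] odd[of "c *\<^sub>R x"]
      by (cases "c \<ge> 0") auto
  qed
qed

section \<open>Norming functionals and supporting hyperplanes\<close>

definition norming_functional :: "'a::real_normed_vector \<Rightarrow> ('a \<Rightarrow> real) \<Rightarrow> bool" where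
  "norming_functional u f \<longleftrightarrow> linear f \<and> (\<forall>x. f x \<le> norm x) \<and> f u = norm u"

text \<open>Applying the one-sided bound to \<open>- x\<close> makes it two-sided, so a norming
  functional is automatically bounded.\<close>

lemma norming_functionalD:
  assumes "norming_functional u f"
  shows "linear f" "f x \<le> norm x" "\<bar>f x\<bar> \<le> norm x" "f u = norm u" "bounded_linear f"
proof -
  show 1: "linear f" "f u = norm u" and 2: "f x \<le> norm x" for x
    using assms by (auto simp: norming_functional_def)
  show 3: "\<bar>f x\<bar> \<le> norm x" for x
    using 2[of x] 2[of "- x"] linear_neg[OF 1(1), of x] by simp
  show "bounded_linear f"
    using 1(1) 3 by (auto intro!: bounded_linear_intro[of f 1] simp: linear_add linear_scale)
qed

text \<open>The norm is first lowered to be odd at \<open>u\<close>, then on a finite spanning set,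
  where it becomes linear. The value at \<open>u\<close> survives: \<open>q u \<le> norm u\<close>
  and \<open>q (- u) \<le> - norm u\<close> leave one possibility.\<close>

lemma norming_functional_exists:
  fixes u :: "'a::real_normed_vector"
  assumes "\<exists>B :: 'a set. finite B \<and> span B = UNIV"
  obtains f where "norming_functional u f"
proof -
  obtain B :: "'a set" where B: "finite B" "span B = UNIV"
    using assms by blast
  have "sublinear (norm :: 'a \<Rightarrow> real)"
    by (simp add: sublinear_def norm_triangle_ineq)
  from sublinear_odd_at[OF this] obtain p
    where p: "sublinear p" "\<And>x. p x \<le> norm x" "p (- u) = - norm u" "p u = norm u"
    by blast
  obtain q where q: "sublinear q" "\<And>x. q x \<le> p x" "\<And>b. b \<in> B \<Longrightarrow> q (- b) = - q b"
    using sublinear_odd_on[OF B(1) p(1)] by blast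
  have "linear q"
    using q B by (intro linear_if_odd_on_spanning)
  moreover have "q x \<le> norm x" for x
    using p(2) q(2) order_trans by blast
  moreover have "q u = norm u"
    using q(2)[of u] q(2)[of "- u"] p(3,4) linear_neg[OF \<open>linear q\<close>, of u] by simp
  ultimately show thesis
    by (intro that[of q]) (simp add: norming_functional_def)
qed

lemma norming_functional_sgn:
  assumes "u \<noteq> 0"
  shows "norming_functional (u /\<^sub>R norm u) f \<longleftrightarrow> norming_functional u f"
  using assms unfolding norming_functional_def by (auto simp: linear_scale field_simps)

text \<open>The height \<open>c\<close> of a supporting hyperplane is positive, and dividing the
  functional by \<open>c\<close> gives a norming one. Fixing the height at 1 removes the scaling
  freedom in the pair of \<open>f\<close> and \<open>c\<close>.\<close>

lemma supporting_hyperplane_cball_iff: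
  assumes u: "norm u = 1"
  shows "supporting_hyperplane (cball 0 1) u H \<longleftrightarrow>
    (\<exists>f. norming_functional u f \<and> H = {x. f x = 1})"
proof
  assume "supporting_hyperplane (cball 0 1) u H"
  then obtain f and c :: real where f: "bounded_linear f" "f \<noteq> (\<lambda>x. 0)" and H: "H = {x. f x = c}"
    and "u \<in> H" "\<forall>x\<in>cball 0 1. f x \<le> c"
    unfolding supporting_hyperplane_def by blast
  then have uc: "f u = c" and le: "\<And>x. norm x \<le> 1 \<Longrightarrow> f x \<le> c"
    by auto
  interpret f: bounded_linear f by fact
  have bound: "f x \<le> c * norm x" for x
  proof (cases "x = 0")
    case False
    then show ?thesis
      using le[of "x /\<^sub>R norm x"] by (simp add: f.scaleR field_simps)
  qed (simp add: f.zero)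
  \<comment> \<open>With \<open>c \<le> 0\<close> the bound would make both \<open>f x\<close> and
    \<open>f (- x)\<close> nonpositive, contradicting \<open>f x \<noteq> 0\<close>.\<close>
  obtain x where "f x \<noteq> 0" using f(2) by auto
  then have "f x > 0 \<or> f (- x) > 0" by (auto simp: f.neg)
  then have "c * norm x > 0"
    using bound[of x] bound[of "- x"] by auto
  then have c: "c > 0"
    by (simp add: zero_less_mult_iff)
  have "linear (\<lambda>x. f x / c)"
    by (intro linearI) (simp_all add: f.add f.scaleR add_divide_distrib)
  moreover have "f x / c \<le> norm x" for x
    using c bound[of x] by (simp add: divide_le_eq mult.commute)
  ultimately have "norming_functional u (\<lambda>x. f x / c)"
    using c uc u by (simp add: norming_functional_def)
  moreover have "H = {x. f x / c = 1}"
    using H c by auto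
  ultimately show "\<exists>f. norming_functional u f \<and> H = {x. f x = 1}"
    by blast
next
  assume "\<exists>f. norming_functional u f \<and> H = {x. f x = 1}"
  then obtain f where f: "norming_functional u f" and H: "H = {x. f x = 1}" by blast
  show "supporting_hyperplane (cball 0 1) u H"
    unfolding supporting_hyperplane_def
    using norming_functionalD(4,5)[OF f] H u
    by (intro exI[of _ f] exI[of _ 1])
      (auto intro: order_trans[OF norming_functionalD(2)[OF f]] dest: fun_cong[of _ _ u])
qed

text \<open>The level set at height 1 determines the functional: points off the kernel scale into
  it, and points of the kernel are translated into it by \<open>u\<close>.\<close>

lemma norming_functional_hyperplane_inj:
  assumes f: "norming_functional u f" and g: "norming_functional u g" and u: "norm u = 1"
    and H: "{x. f x = 1} = {x. g x = 1}"
  shows "f = g"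
proof
  fix x
  note fD = norming_functionalD[OF f] and gD = norming_functionalD[OF g]
  have iff: "f y = 1 \<longleftrightarrow> g y = 1" for y using H by auto
  show "f x = g x"
  proof (cases "f x = 0")
    case True
    then show ?thesis
      using iff[of "x + u"] fD(4) gD(4) u linear_add[OF fD(1)] linear_add[OF gD(1)] by simp
  next
    case False
    then show ?thesis
      using iff[of "x /\<^sub>R f x"] linear_scale[OF fD(1)] linear_scale[OF gD(1)]
      by (simp add: field_simps)
  qed
qed

text \<open>Hyperplanes correspond bijectively to norming functionals, and these do not change under
  positive scaling of \<open>u\<close>. All later smoothness arguments go through this form.\<close>

lemma smooth_point_iff_norming:
  "smooth_point u \<longleftrightarrow> u \<noteq> 0 \<and> (\<exists>!f. norming_functional u f)"
proof (cases "u = 0")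
  case False
  define v where "v = u /\<^sub>R norm u"
  have v: "norm v = 1" using False by (simp add: v_def)
  have "(\<exists>!H. supporting_hyperplane (cball 0 1) v H) \<longleftrightarrow> (\<exists>!f. norming_functional v f)"
    unfolding supporting_hyperplane_cball_iff[OF v]
    using norming_functional_hyperplane_inj[OF _ _ v] by metis
  then show ?thesis
    using False v norming_functional_sgn[OF False]
    by (simp add: smooth_point_def smooth_at_def v_def)
qed (simp add: smooth_point_def)

section \<open>Compactness in finite dimension\<close>

text \<open>A convergent sequence is bounded, so it stays in one of the balls, where compactness
  keeps its limit in \<open>S\<close>.\<close>

lemma closed_if_compact_Int_cball:
  fixes S :: "'a::real_normed_vector set"
  assumes "\<And>r. compact (S \<inter> cball 0 r)"
  shows "closed S"
  unfolding closed_sequential_limits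
proof (intro allI impI)
  fix X l assume X: "(\<forall>n. X n \<in> S) \<and> X \<longlonglongrightarrow> l"
  then have "Bseq X"
    by (intro convergent_imp_Bseq convergentI) auto
  then obtain r where "\<And>n. norm (X n) \<le> r"
    by (auto simp: Bseq_def)
  then have "\<forall>n. X n \<in> S \<inter> cball 0 r" using X by auto
  then show "l \<in> S"
    using compact_imp_closed[OF assms[of r]] X unfolding closed_sequential_limits by blast
qed

text \<open>Induction on the spanning set. A new vector \<open>b\<close> outside the closed span has
  positive distance \<open>d\<close> from it, which bounds the coefficient of \<open>b\<close> in
  any vector of norm at most \<open>r\<close>; the ball then lies in a continuous image of a compact
  product.\<close>

lemma compact_span_Int_cball:
  fixes B :: "'a::real_normed_vector set"
  assumes "finite B"
  shows "compact (span B \<inter> cball 0 r)"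
  using assms
proof (induction B arbitrary: r rule: finite_induct)
  case empty
  show ?case by (rule finite_imp_compact) simp
next
  case (insert b B)
  show ?case
  proof (cases "b \<in> span B")
    case True
    then show ?thesis using insert.IH by (simp add: span_redundant)
  next
    case False
    have cl: "closed (span B)"
      using insert.IH by (rule closed_if_compact_Int_cball)
    define d where "d = infdist b (span B)"
    have ne: "span B \<noteq> {}" using span_zero by blast
    have d: "d > 0"
      using in_closed_iff_infdist_zero[OF cl ne, of b] False infdist_nonneg[of b "span B"]
      by (simp add: d_def less_le)
    \<comment> \<open>\<open>r / d\<close> bounds the coefficient of \<open>b\<close>; the triangle
      inequality then bounds the remaining component by \<open>r + r / d * norm b\<close>.\<close>
    define C where "C = (\<lambda>(c, y). c *\<^sub>R b + y) `
      ({- (r / d) .. r / d} \<times> (span B \<inter> cball 0 (r + r / d * norm b)))"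
    have coeff: "\<bar>c\<bar> * d \<le> norm (c *\<^sub>R b + y)" if "y \<in> span B" for c y
    proof (cases "c = 0")
      case False
      have "- (y /\<^sub>R c) \<in> span B"
        using that by (intro span_neg span_scale)
      then have "d \<le> norm (b + y /\<^sub>R c)"
        using infdist_le[of "- (y /\<^sub>R c)" "span B" b] by (simp add: d_def dist_norm)
      then have "\<bar>c\<bar> * d \<le> \<bar>c\<bar> * norm (b + y /\<^sub>R c)"
        by (rule mult_left_mono) simp
      also have "\<dots> = norm (c *\<^sub>R (b + y /\<^sub>R c))"
        by simp
      also have "c *\<^sub>R (b + y /\<^sub>R c) = c *\<^sub>R b + y"
        using False by (simp add: scaleR_add_right)
      finally show ?thesis .
    qed simp
    have "compact C"
      unfolding C_def case_prod_beta
      by (intro compact_continuous_image compact_Times insert.IH continuous_intros) simp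
    moreover have "span (insert b B) \<inter> cball 0 r = C \<inter> cball 0 r"
    proof (intro equalityI subsetI)
      fix x assume x: "x \<in> span (insert b B) \<inter> cball 0 r"
      then obtain c where c: "x - c *\<^sub>R b \<in> span B"
        using span_breakdown_eq[of x b B] by auto
      define y where "y = x - c *\<^sub>R b"
      have xy: "x = c *\<^sub>R b + y" and y: "y \<in> span B" using c by (auto simp: y_def)
      have "\<bar>c\<bar> * d \<le> r"
        using coeff[OF y, of c] x xy by simp
      then have c: "\<bar>c\<bar> \<le> r / d"
        using d by (simp add: field_simps)
      have "norm y \<le> norm x + norm (c *\<^sub>R b)"
        unfolding y_def by (rule norm_triangle_ineq4)
      also have "\<dots> \<le> r + r / d * norm b"
        using x mult_right_mono[OF c norm_ge_zero[of b]] by simp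
      finally show "x \<in> C \<inter> cball 0 r"
        using x xy y c by (auto simp: C_def intro!: image_eqI[of _ _ "(c, y)"])
    next
      fix x assume "x \<in> C \<inter> cball 0 r"
      then show "x \<in> span (insert b B) \<inter> cball 0 r"
        by (auto simp: C_def intro!: span_add span_scale intro: span_base span_mono[THEN subsetD, of B])
    qed
    ultimately show ?thesis
      by (simp add: compact_Int_closed)
  qed
qed

lemma compact_cball_finite_dim:
  assumes "\<exists>B :: 'a::real_normed_vector set. finite B \<and> span B = UNIV"
  shows "compact (cball (0 :: 'a) r)"
  using assms compact_span_Int_cball by (metis Int_UNIV_left)

text \<open>The maximum norm induces the product topology, so its sphere is a closed subset of a
  product of two compact balls.\<close>

lemma compact_prod_sphere:
  assumes "\<exists>B :: 'a::real_normed_vector set. finite B \<and> span B = UNIV"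
    and "\<exists>B :: 'b::real_normed_vector set. finite B \<and> span B = UNIV"
  shows "compact (prod_sphere :: ('a \<times> 'b) set)"
proof -
  have "(prod_sphere :: ('a \<times> 'b) set) =
      (cball 0 1 \<times> cball 0 1) \<inter> {p. max (norm (fst p)) (norm (snd p)) = 1}"
    by (auto simp: prod_sphere_def)
  moreover have "closed {p :: 'a \<times> 'b. max (norm (fst p)) (norm (snd p)) = 1}"
    by (intro closed_Collect_eq continuous_intros)
  ultimately show ?thesis
    using compact_Int_closed compact_Times compact_cball_finite_dim[OF assms(1)]
      compact_cball_finite_dim[OF assms(2)] by metis
qed

section \<open>Norm attainment of bilinear operators\<close>

lemma norm_attainment_set_nonempty:
  fixes T :: "('a::real_normed_vector, 'b::real_normed_vector, 'c::real_normed_vector) bounded_bilin"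
  assumes "compact (prod_sphere :: ('a \<times> 'b) set)" and "(prod_sphere :: ('a \<times> 'b) set) \<noteq> {}"
  obtains x y where "(x, y) \<in> norm_attainment_set T"
proof -
  have "continuous_on prod_sphere (\<lambda>p. norm (bilin_apply T (fst p) (snd p)))"
    by (intro continuous_intros bounded_bilinear.continuous_on[OF bounded_bilinear_bilin_apply])
  from continuous_attains_sup[OF assms this] obtain x y where
    xy: "(x, y) \<in> prod_sphere"
    and sup: "\<And>x' y'. (x', y') \<in> prod_sphere \<Longrightarrow> norm (bilin_apply T x' y') \<le> norm (bilin_apply T x y)"
    by fastforce
  have "norm T \<le> norm (bilin_apply T x y)"
    using sup by (intro norm_bounded_bilin_le) auto
  then have "(x, y) \<in> norm_attainment_set T"
    using xy norm_bilin_apply_le[OF xy, of T] by (simp add: norm_attainment_set_def)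
  then show thesis by (rule that)
qed

lemma norm_attainment_setD:
  assumes "(x, y) \<in> norm_attainment_set T"
  shows "(x, y) \<in> prod_sphere" "norm (bilin_apply T x y) = norm T"
  using assms by (auto simp: norm_attainment_set_def)

text \<open>Membership in \<open>prod_sphere\<close> only says that the larger norm is 1. If the
  other were smaller, rescaling both arguments to norm 1 would push the value of \<open>T\<close>
  above \<open>norm T\<close>.\<close>

lemma norm_attainment_set_norm_1:
  assumes xy: "(x, y) \<in> norm_attainment_set T" and T: "T \<noteq> 0"
  shows "norm x = 1" "norm y = 1"
proof -
  interpret bounded_bilinear "bilin_apply T"
    by (rule bounded_bilinear_bilin_apply)
  have nz: "x \<noteq> 0" "y \<noteq> 0"
    using norm_attainment_setD(2)[OF xy] T by (auto simp: zero_left zero_right)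
  have le: "norm x \<le> 1" "norm y \<le> 1" and max: "max (norm x) (norm y) = 1"
    using norm_attainment_setD(1)[OF xy] by (auto simp: prod_sphere_def)
  have "(sgn x, sgn y) \<in> prod_sphere"
    using nz by (simp add: prod_sphere_def norm_sgn)
  from norm_bilin_apply_le[OF this, of T] have "norm T / (norm x * norm y) \<le> norm T"
    using nz norm_attainment_setD(2)[OF xy]
    by (simp add: sgn_div_norm scaleR_left scaleR_right field_simps)
  then have "1 \<le> norm x * norm y"
    using nz T by (simp add: field_simps)
  moreover have "norm x * norm y \<le> norm x" "norm x * norm y \<le> norm y"
    using le by (simp_all add: mult_left_le mult_left_le_one_le)
  ultimately show "norm x = 1" "norm y = 1"
    using le by linarith+
qed

lemma norm_attainment_set_sign:
  assumes "(x, y) \<in> norm_attainment_set T"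
  shows "{(x, y), (x, - y), (- x, y), (- x, - y)} \<subseteq> norm_attainment_set T"
proof -
  interpret bounded_bilinear "bilin_apply T"
    by (rule bounded_bilinear_bilin_apply)
  show ?thesis
    using assms by (auto simp: norm_attainment_set_def prod_sphere_def minus_left minus_right)
qed

section \<open>Evaluation functionals and rank-one test operators\<close>

lemma norming_functional_evaluation:
  assumes xy: "(x, y) \<in> norm_attainment_set T"
    and g: "norming_functional (bilin_apply T x y) g"
  shows "norming_functional T (\<lambda>S. g (bilin_apply S x y))"
proof -
  note gD = norming_functionalD[OF g] and xyD = norm_attainment_setD[OF xy]
  have "linear (\<lambda>S. g (bilin_apply S x y))"
    by (intro linearI) (simp_all add: plus_bounded_bilin.rep_eq scaleR_bounded_bilin.rep_eq
        linear_add[OF gD(1)] linear_scale[OF gD(1)])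
  moreover have "g (bilin_apply S x y) \<le> norm S" for S
    using gD(2) norm_bilin_apply_le[OF xyD(1)] by (rule order_trans)
  ultimately show ?thesis
    using gD(4) xyD(2) by (simp add: norming_functional_def)
qed

text \<open>When \<open>a x = 1\<close> and \<open>b y = 1\<close>, the map
  \<open>rank_one a b\<close> is a linear right inverse of the evaluation of operators at
  \<open>(x, y)\<close>.\<close>

lift_definition rank_one ::
  "('a::real_normed_vector \<Rightarrow>\<^sub>L real) \<Rightarrow> ('b::real_normed_vector \<Rightarrow>\<^sub>L real) \<Rightarrow>
    'c::real_normed_vector \<Rightarrow> ('a, 'b, 'c) bounded_bilin"
  is "\<lambda>a b w x y. (a x * b y) *\<^sub>R w"
proof -
  fix a :: "'a \<Rightarrow> real" and b :: "'b \<Rightarrow> real" and w :: 'c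
  assume ab: "bounded_linear a" "bounded_linear b"
  have "bounded_bilinear (\<lambda>x y. a x * b y)"
    using bounded_bilinear.comp[OF bounded_bilinear_mult ab] .
  then interpret bounded_bilinear "\<lambda>x y. a x * b y" .
  obtain K where K: "\<And>x y. norm (a x * b y) \<le> norm x * norm y * K"
    using bounded by blast
  show "bounded_bilinear (\<lambda>x y. (a x * b y) *\<^sub>R w)"
  proof (intro bounded_bilinear.intro exI[of _ "K * norm w"] allI)
    fix x y
    show "norm ((a x * b y) *\<^sub>R w) \<le> norm x * norm y * (K * norm w)"
      using mult_right_mono[OF K[of x y], of "norm w"] by (simp add: mult.assoc)
  qed (simp_all add: add_left add_right scaleR_left scaleR_right scaleR_add_left)
qed

lemma norming_blinfun_exists:
  fixes u :: "'a::real_normed_vector"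
  assumes "\<exists>B :: 'a set. finite B \<and> span B = UNIV"
  obtains a :: "'a \<Rightarrow>\<^sub>L real" where "blinfun_apply a u = norm u"
proof -
  obtain f where f: "norming_functional u f"
    using norming_functional_exists[OF assms] by blast
  show thesis
    using norming_functionalD(4,5)[OF f]
    by (intro that[of "Blinfun f"]) (simp add: bounded_linear_Blinfun_apply)
qed

text \<open>Functionals separate points: one that norms \<open>x - k *\<^sub>R y\<close> also
  vanishes there.\<close>

lemma eq_scaleR_if_functionals:
  fixes x y :: "'a::real_normed_vector"
  assumes fin: "\<exists>B :: 'a set. finite B \<and> span B = UNIV"
    and eq: "\<And>a :: 'a \<Rightarrow>\<^sub>L real. a x = k * a y"
  shows "x = k *\<^sub>R y"
proof -
  obtain a :: "'a \<Rightarrow>\<^sub>L real" where a: "a (x - k *\<^sub>R y) = norm (x - k *\<^sub>R y)"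
    using norming_blinfun_exists[OF fin] by blast
  show ?thesis
    using a eq[of a] by (simp add: blinfun.diff_right blinfun.scaleR_right)
qed

lemma eq_or_minus_if_norm_1:
  fixes x y :: "'a::real_normed_vector"
  assumes "x = k *\<^sub>R y" "norm x = 1" "norm y = 1"
  shows "x = y \<or> x = - y"
  using assms by (cases "k \<ge> 0") auto

text \<open>On rank-one operators the identity splits into products of three factors. Fixing two of
  them shows that \<open>x\<close> is a multiple of \<open>x'\<close> and \<open>y\<close> of
  \<open>y'\<close>; unit norms leave only the signs.\<close>

lemma evaluation_functional_eq:
  fixes g g' :: "'c::real_normed_vector \<Rightarrow> real"
    and x x' :: "'a::real_normed_vector" and y y' :: "'b::real_normed_vector"
  assumes fin: "\<exists>B :: 'a set. finite B \<and> span B = UNIV" "\<exists>B :: 'b set. finite B \<and> span B = UNIV"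
    and norm: "norm x = 1" "norm x' = 1" "norm y = 1" "norm y' = 1"
    and lin: "linear g" "linear g'" and g: "g \<noteq> (\<lambda>z. 0)"
    and eq: "\<And>S :: ('a, 'b, 'c) bounded_bilin. g (bilin_apply S x y) = g' (bilin_apply S x' y')"
  shows "(x' = x \<or> x' = - x) \<and> (y' = y \<or> y' = - y)"
proof -
  have eq': "a x * b y * g z = a x' * b y' * g' z"
    for a :: "'a \<Rightarrow>\<^sub>L real" and b :: "'b \<Rightarrow>\<^sub>L real" and z
    using eq[of "rank_one a b z"] by (simp add: rank_one.rep_eq linear_scale[OF lin(1)] linear_scale[OF lin(2)])
  obtain z where z: "g z \<noteq> 0" using g by auto
  obtain a :: "'a \<Rightarrow>\<^sub>L real" where a: "a x = 1"
    using norming_blinfun_exists[OF fin(1), of x] norm by auto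
  obtain b :: "'b \<Rightarrow>\<^sub>L real" where b: "b y = 1"
    using norming_blinfun_exists[OF fin(2), of y] norm by auto
  \<comment> \<open>The scalar comes from solving \<open>eq'\<close> for the first factor, with
    \<open>b y = 1\<close> and \<open>g z \<noteq> 0\<close>.\<close>
  have "x = (b y' * g' z / g z) *\<^sub>R x'"
    using fin(1)
  proof (rule eq_scaleR_if_functionals)
    fix c :: "'a \<Rightarrow>\<^sub>L real"
    show "c x = b y' * g' z / g z * c x'"
      using eq'[of c b z] z b by (simp add: field_simps)
  qed
  moreover have "y = (a x' * g' z / g z) *\<^sub>R y'"
    using fin(2)
  proof (rule eq_scaleR_if_functionals)
    fix c :: "'b \<Rightarrow>\<^sub>L real"
    show "c y = a x' * g' z / g z * c y'"
      using eq'[of a c z] z a by (simp add: field_simps)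
  qed
  ultimately show ?thesis
    using eq_or_minus_if_norm_1[of x _ x'] eq_or_minus_if_norm_1[of y _ y'] norm by fastforce
qed

section \<open>From smoothness to the norm attainment set\<close>

lemma bounded_bilin_nonzero_imp_prod_sphere_nonempty:
  fixes T :: "('a::real_normed_vector, 'b::real_normed_vector, 'c::real_normed_vector) bounded_bilin"
  assumes "T \<noteq> 0"
  shows "(prod_sphere :: ('a \<times> 'b) set) \<noteq> {}"
  \<comment> \<open>On an empty sphere the bound 0 holds vacuously, which would force
    \<open>norm T = 0\<close>.\<close>
  using norm_bounded_bilin_le[of 0 T] assms by auto

lemma smooth_point_imp_attainment:
  fixes T :: "('a::real_normed_vector, 'b::real_normed_vector, 'c::real_normed_vector) bounded_bilin"
  assumes fin: "\<exists>B :: 'a set. finite B \<and> span B = UNIV" "\<exists>B :: 'b set. finite B \<and> span B = UNIV"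
      "\<exists>B :: 'c set. finite B \<and> span B = UNIV"
    and smooth: "smooth_point T"
  obtains x y where "(x, y) \<in> prod_sphere"
    "norm_attainment_set T = {(x, y), (x, - y), (- x, y), (- x, - y)}"
    "smooth_point (bilin_apply T x y)"
proof -
  have T: "T \<noteq> 0" and unique: "\<And>f h. norming_functional T f \<Longrightarrow> norming_functional T h \<Longrightarrow> f = h"
    using smooth by (auto simp: smooth_point_iff_norming)
  obtain x y where xy: "(x, y) \<in> norm_attainment_set T"
    using norm_attainment_set_nonempty[OF compact_prod_sphere[OF fin(1,2)]
        bounded_bilin_nonzero_imp_prod_sphere_nonempty[OF T]] by blast
  note xyD = norm_attainment_setD[OF xy] and xy1 = norm_attainment_set_norm_1[OF xy T]
  have z: "bilin_apply T x y \<noteq> 0" using xyD(2) T by auto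
  obtain g where g: "norming_functional (bilin_apply T x y) g"
    using norming_functional_exists[OF fin(3)] by blast
  \<comment> \<open>Both sides, as functionals of \<open>S\<close>, norm \<open>T\<close>, so
    smoothness identifies them.\<close>
  have eval_eq: "g (bilin_apply S x y) = g' (bilin_apply S x' y')"
    if "(x', y') \<in> norm_attainment_set T" "norming_functional (bilin_apply T x' y') g'" for x' y' g' S
    using fun_cong[OF unique[OF norming_functional_evaluation[OF xy g] norming_functional_evaluation[OF that]]] .
  have "(x', y') \<in> {(x, y), (x, - y), (- x, y), (- x, - y)}" if xy': "(x', y') \<in> norm_attainment_set T" for x' y'
  proof -
    obtain g' where g': "norming_functional (bilin_apply T x' y') g'"
      using norming_functional_exists[OF fin(3)] by blast
    have "g \<noteq> (\<lambda>z. 0)" using norming_functionalD(4)[OF g] z by auto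
    from evaluation_functional_eq[OF fin(1,2) xy1(1) norm_attainment_set_norm_1(1)[OF xy' T] xy1(2)
        norm_attainment_set_norm_1(2)[OF xy' T] norming_functionalD(1)[OF g]
        norming_functionalD(1)[OF g'] this eval_eq[OF xy' g']]
    show ?thesis by auto
  qed
  then have "norm_attainment_set T = {(x, y), (x, - y), (- x, y), (- x, - y)}"
    using norm_attainment_set_sign[OF xy] by auto
  moreover have "smooth_point (bilin_apply T x y)"
    unfolding smooth_point_iff_norming
  proof (intro conjI z ex1I[of _ g] g ext)
    fix g' w assume g': "norming_functional (bilin_apply T x y) g'"
    obtain a :: "'a \<Rightarrow>\<^sub>L real" where a: "a x = 1"
      using norming_blinfun_exists[OF fin(1), of x] xy1 by auto
    obtain b :: "'b \<Rightarrow>\<^sub>L real" where b: "b y = 1"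
      using norming_blinfun_exists[OF fin(2), of y] xy1 by auto
    show "g' w = g w"
      using eval_eq[OF xy g', of "rank_one a b w"] a b by (simp add: rank_one.rep_eq)
  qed
  ultimately show thesis
    using xyD(1) that by blast
qed

section \<open>From the norm attainment set to smoothness\<close>

lemma norm_difference_quotient_mono:
  fixes z w :: "'a::real_normed_vector"
  assumes "0 < t" "t \<le> s"
  shows "(norm (z + t *\<^sub>R w) - norm z) / t \<le> (norm (z + s *\<^sub>R w) - norm z) / s"
proof -
  have s: "s > 0" using assms by simp
  \<comment> \<open>Convexity: the nearer point is a convex combination of \<open>z\<close> and the
    farther one, with weight \<open>t / s\<close>.\<close>
  have "z + t *\<^sub>R w = (1 - t / s) *\<^sub>R z + (t / s) *\<^sub>R (z + s *\<^sub>R w)"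
    using s by (simp add: algebra_simps)
  then have "norm (z + t *\<^sub>R w) \<le> norm ((1 - t / s) *\<^sub>R z) + norm ((t / s) *\<^sub>R (z + s *\<^sub>R w))"
    by (metis norm_triangle_ineq)
  also have "\<dots> = (1 - t / s) * norm z + (t / s) * norm (z + s *\<^sub>R w)"
    using assms s by simp
  finally have "norm (z + t *\<^sub>R w) - norm z \<le> t * ((norm (z + s *\<^sub>R w) - norm z) / s)"
    by (simp add: algebra_simps diff_divide_distrib)
  then show ?thesis
    using assms(1) by (simp add: divide_le_eq mult.commute)
qed

text \<open>
  Maximizers of \<open>T + t S\<close> accumulate, as \<open>t \<rightarrow> 0\<close>, at the norm attainment set of \<open>T\<close>, while
  convexity bounds the difference quotient at step \<open>t\<close> by the one at the fixed step \<open>s\<close>, which is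
  continuous in the maximizer.
\<close>

lemma norming_functional_le_difference_quotient:
  fixes T :: "('a::real_normed_vector, 'b::real_normed_vector, 'c::real_normed_vector) bounded_bilin"
  assumes cpt: "compact (prod_sphere :: ('a \<times> 'b) set)"
    and attain: "norm_attainment_set T = {(x0, y0), (x0, - y0), (- x0, y0), (- x0, - y0)}"
    and \<phi>: "norming_functional T \<phi>" and s: "s > 0"
  shows "\<phi> S \<le> (norm (bilin_apply T x0 y0 + s *\<^sub>R bilin_apply S x0 y0) - norm (bilin_apply T x0 y0)) / s"
proof -
  interpret T: bounded_bilinear "bilin_apply T"
    by (rule bounded_bilinear_bilin_apply)
  interpret S: bounded_bilinear "bilin_apply S"
    by (rule bounded_bilinear_bilin_apply)
  define Q where "Q x y = (norm (bilin_apply T x y + s *\<^sub>R bilin_apply S x y) - norm (bilin_apply T x y)) / s" for x y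
  \<comment> \<open>A positive null sequence that never exceeds \<open>s\<close>, so that the
    quotient at step \<open>t n\<close> is bounded by the one at step \<open>s\<close>.\<close>
  define t where "t n = s / real (Suc n)" for n
  have t: "0 < t n" "t n \<le> s" for n
    using s by (auto simp: t_def field_simps)
  have t0: "t \<longlonglongrightarrow> 0"
    unfolding t_def by (rule LIMSEQ_Suc[OF lim_const_over_n])
  have "(prod_sphere :: ('a \<times> 'b) set) \<noteq> {}"
    using attain by (auto simp: norm_attainment_set_def)
  from norm_attainment_set_nonempty[OF cpt this]
  have "\<forall>n. \<exists>p. p \<in> norm_attainment_set (T + t n *\<^sub>R S)"
    by metis
  then obtain p where p: "\<And>n. p n \<in> norm_attainment_set (T + t n *\<^sub>R S)"
    by metis
  define X Y where "X = fst \<circ> p" and "Y = snd \<circ> p"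
  have XY: "(X n, Y n) \<in> norm_attainment_set (T + t n *\<^sub>R S)" for n
    using p[of n] by (simp add: X_def Y_def)
  note XYD = norm_attainment_setD[OF XY]
  \<comment> \<open>The norm of \<open>T + t n *\<^sub>R S\<close> is attained at
    \<open>(X n, Y n)\<close> and dominates \<open>norm T + t n * \<phi> S\<close>, while
    \<open>T\<close> itself has norm at most \<open>norm T\<close> there.\<close>
  have le_Q: "\<phi> S \<le> Q (X n) (Y n)" for n
  proof -
    let ?z = "bilin_apply T (X n) (Y n)" and ?w = "bilin_apply S (X n) (Y n)"
    have "norm T + t n * \<phi> S = \<phi> (T + t n *\<^sub>R S)"
      using norming_functionalD[OF \<phi>] by (simp add: linear_add linear_scale)
    also have "\<dots> \<le> norm (T + t n *\<^sub>R S)"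
      by (rule norming_functionalD(2)[OF \<phi>])
    also have "\<dots> = norm (?z + t n *\<^sub>R ?w)"
      using XYD(2)[of n] by (simp add: plus_bounded_bilin.rep_eq scaleR_bounded_bilin.rep_eq)
    finally have "t n * \<phi> S \<le> norm (?z + t n *\<^sub>R ?w) - norm ?z"
      using norm_bilin_apply_le[OF XYD(1), of T n] by simp
    then have "\<phi> S \<le> (norm (?z + t n *\<^sub>R ?w) - norm ?z) / t n"
      using t(1)[of n] by (simp add: field_simps)
    also have "\<dots> \<le> Q (X n) (Y n)"
      unfolding Q_def by (rule norm_difference_quotient_mono[OF t])
    finally show ?thesis .
  qed
  have "\<forall>n. p n \<in> prod_sphere"
    using XYD(1) by (simp add: X_def Y_def)
  then obtain q r where q: "q \<in> prod_sphere" and r: "strict_mono r" and lim: "(p \<circ> r) \<longlonglongrightarrow> q"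
    using cpt unfolding compact_def by blast
  obtain x y where xy: "q = (x, y)" by (cases q)
  have Xl: "(\<lambda>n. X (r n)) \<longlonglongrightarrow> x" and Yl: "(\<lambda>n. Y (r n)) \<longlonglongrightarrow> y"
    using tendsto_fst[OF lim] tendsto_snd[OF lim] by (simp_all add: X_def Y_def xy o_def)
  have tr: "(\<lambda>n. t (r n)) \<longlonglongrightarrow> 0"
    using LIMSEQ_subseq_LIMSEQ[OF t0 r] by (simp add: o_def)
  \<comment> \<open>The norms of the perturbed operators converge both to the value at the limit
    point and to \<open>norm T\<close>, so the limit point attains the norm of
    \<open>T\<close>.\<close>
  have "(\<lambda>n. norm (bilin_apply T (X (r n)) (Y (r n)) + t (r n) *\<^sub>R bilin_apply S (X (r n)) (Y (r n))))
      \<longlonglongrightarrow> norm (bilin_apply T x y + 0 *\<^sub>R bilin_apply S x y)"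
    by (intro tendsto_intros T.tendsto S.tendsto Xl Yl tr)
  then have "(\<lambda>n. norm (T + t (r n) *\<^sub>R S)) \<longlonglongrightarrow> norm (bilin_apply T x y)"
    using XYD(2) by (simp add: plus_bounded_bilin.rep_eq scaleR_bounded_bilin.rep_eq)
  moreover have "(\<lambda>n. norm (T + t (r n) *\<^sub>R S)) \<longlonglongrightarrow> norm (T + 0 *\<^sub>R S)"
    by (intro tendsto_intros tr)
  ultimately have "norm (bilin_apply T x y) = norm T"
    using LIMSEQ_unique by fastforce
  then have "(x, y) \<in> norm_attainment_set T"
    using q by (simp add: norm_attainment_set_def xy)
  \<comment> \<open>A sign change in the arguments multiplies the values of \<open>T\<close> and
    \<open>S\<close> by the same sign, which the norm ignores.\<close>
  then have "Q x y = Q x0 y0"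
    using attain norm_minus_cancel[of "bilin_apply T x0 y0 + s *\<^sub>R bilin_apply S x0 y0"]
    by (auto simp: Q_def T.minus_left T.minus_right S.minus_left S.minus_right norm_minus_commute)
  moreover have "(\<lambda>n. Q (X (r n)) (Y (r n))) \<longlonglongrightarrow> Q x y"
    unfolding Q_def using s by (intro tendsto_intros T.tendsto S.tendsto Xl Yl) simp
  ultimately show ?thesis
    using LIMSEQ_le_const[of _ "Q x y" "\<phi> S"] le_Q unfolding Q_def by fastforce
qed

text \<open>Any \<open>\<phi>\<close> norming \<open>T\<close> vanishes on operators that vanish at
  \<open>(x, y)\<close>, hence factors through evaluation there. The factor norms
  \<open>T x y\<close>, so smoothness in the codomain determines it.\<close>

lemma attainment_imp_smooth_point:
  fixes T :: "('a::real_normed_vector, 'b::real_normed_vector, 'c::real_normed_vector) bounded_bilin"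
  assumes fin: "\<exists>B :: 'a set. finite B \<and> span B = UNIV" "\<exists>B :: 'b set. finite B \<and> span B = UNIV"
    and T: "T \<noteq> 0"
    and attain: "norm_attainment_set T = {(x, y), (x, - y), (- x, y), (- x, - y)}"
    and smooth: "smooth_point (bilin_apply T x y)"
  shows "smooth_point T"
proof -
  define z where "z = bilin_apply T x y"
  have xy: "(x, y) \<in> norm_attainment_set T" using attain by simp
  note xy1 = norm_attainment_set_norm_1[OF xy T]
  obtain g where g: "norming_functional z g" and unique: "\<And>h. norming_functional z h \<Longrightarrow> h = g"
    using smooth unfolding smooth_point_iff_norming z_def by auto
  obtain a :: "'a \<Rightarrow>\<^sub>L real" where a: "a x = 1"
    using norming_blinfun_exists[OF fin(1), of x] xy1 by auto
  obtain b :: "'b \<Rightarrow>\<^sub>L real" where b: "b y = 1"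
    using norming_blinfun_exists[OF fin(2), of y] xy1 by auto
  have "\<phi> = (\<lambda>S. g (bilin_apply S x y))" if \<phi>: "norming_functional T \<phi>" for \<phi>
  proof -
    note lin = norming_functionalD(1)[OF \<phi>]
    have quot: "\<phi> S \<le> (norm (z + s *\<^sub>R bilin_apply S x y) - norm z) / s" if "s > 0" for S s
      unfolding z_def
      by (rule norming_functional_le_difference_quotient[OF compact_prod_sphere[OF fin] attain \<phi> that])
    \<comment> \<open>The quotient is 0 for both \<open>S\<close> and \<open>- S\<close>.\<close>
    have vanish: "\<phi> S = 0" if "bilin_apply S x y = 0" for S
      using quot[of 1 S] quot[of 1 "- S"] that linear_neg[OF lin, of S]
      by (simp add: uminus_bounded_bilin.rep_eq)
    define \<psi> where "\<psi> w = \<phi> (rank_one a b w)" for w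
    have \<phi>_eq: "\<phi> S = \<psi> (bilin_apply S x y)" for S
    proof -
      have "\<phi> (S - rank_one a b (bilin_apply S x y)) = 0"
        using a b by (intro vanish) (simp add: diff_conv_add_uminus plus_bounded_bilin.rep_eq
            uminus_bounded_bilin.rep_eq rank_one.rep_eq del: add_uminus_conv_diff)
      then show ?thesis by (simp add: \<psi>_def linear_diff[OF lin])
    qed
    have \<psi>_quot: "\<psi> w \<le> (norm (z + s *\<^sub>R w) - norm z) / s" if "s > 0" for w s
      using quot[OF that, of "rank_one a b w"] a b by (simp add: \<psi>_def rank_one.rep_eq)
    have "rank_one a b (v + w) = rank_one a b v + rank_one a b w" for v w :: 'c
      by (intro bounded_bilin_eqI) (simp add: plus_bounded_bilin.rep_eq rank_one.rep_eq scaleR_add_right)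
    moreover have "rank_one a b (c *\<^sub>R w) = c *\<^sub>R rank_one a b w" for c and w :: 'c
      by (intro bounded_bilin_eqI) (simp add: scaleR_bounded_bilin.rep_eq rank_one.rep_eq)
    ultimately have lin\<psi>: "linear \<psi>"
      by (intro linearI) (simp_all add: \<psi>_def linear_add[OF lin] linear_scale[OF lin])
    \<comment> \<open>At step 1 the triangle inequality bounds the difference quotient by
      \<open>norm w\<close>.\<close>
    have "\<psi> w \<le> norm w" for w
      using \<psi>_quot[of 1 w] norm_triangle_ineq[of z w] by simp
    moreover have "\<psi> z = norm z"
      using norming_functionalD(4)[OF \<phi>] \<phi>_eq[of T] norm_attainment_setD(2)[OF xy]
      by (simp add: z_def)
    ultimately have "\<psi> = g"
      using lin\<psi> by (intro unique) (simp add: norming_functional_def)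
    then show ?thesis using \<phi>_eq by auto
  qed
  then show ?thesis
    unfolding smooth_point_iff_norming
    using T norming_functional_evaluation[OF xy g[unfolded z_def]] by auto
qed

theorem theorem2p5:
  fixes T :: "('x::banach, 'y::banach, 'z::banach) bounded_bilin"
  assumes "\<exists>B :: 'x set. finite B \<and> span B = UNIV" and "dim (UNIV :: 'x set) > 1"
    and "\<exists>B :: 'y set. finite B \<and> span B = UNIV" and "dim (UNIV :: 'y set) > 1"
    and "\<exists>B :: 'z set. finite B \<and> span B = UNIV" and "dim (UNIV :: 'z set) > 1"
    and "T \<noteq> 0"
  shows "smooth_point T \<longleftrightarrow>
    (\<exists>x0 y0. (x0, y0) \<in> prod_sphere \<and>
      norm_attainment_set T = {(x0, y0), (x0, - y0), (- x0, y0), (- x0, - y0)} \<and>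
      smooth_point (bilin_apply T x0 y0))"
  using smooth_point_imp_attainment[OF assms(1,3,5)] attainment_imp_smooth_point[OF assms(1,3,7)]
  by metis

end
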